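(* When the two-step algorithm of the context is run with the biased estimator and the Laplace query in Step 2 (with an arbitrary assignment $\rho$), its output $\tilde k$ satisfies $$\mathbb{E}\big[(\tilde k-f(G))^2\big]=O\!\left(\frac{d_{\max}m}{\varepsilon_2^2}+\frac{|\Delta|^2}{\varepsilon_1^2}+\frac{\#C'_4}{\varepsilon_1}\right).$$
   Context: Let $G=(V,E,w)$ be a finite simple undirected graph, $V=\{1,\dots,n\}$, $m=|E|$, maximum degree $d_{\max}$, integer weights $w_{uv}=w_{vu}$; $\mathcal N(v)$ is the neighborhood of $v$, $w^v=(w_{vu})_{u\in\mathcal N(v)}$. Let $\Delta$ be the set of triangles, $w_T$ the sum of the three edge weights of $T$, $\lambda\in\mathbb{Z}$, and $f(G)=|\{T\in\Delta:w_T<\lambda\}|$. Let $\varepsilon_1,\varepsilon_2>0$, $p=e^{-\varepsilon_1}$; $\mathrm{DLap}(p)$ has mass $\frac{1-p}{1+p}p^{|i|}$ at $i\in\mathbb{Z}$; $\mathrm{Lap}(b)$ has density $\frac1{2b}e^{-|y|/b}$. Algorithm: Step 1: each $v$ reports $\tilde w_{vu}=w_{vu}+Y_{vu}$ for $u\in\mathcal N(v)$, all $Y_{vu}$ i.i.d. $\mathrm{DLap}(p)$; for each edge set $w'_{uv}=w'_{vu}=\tilde w_{uv}$ if $u<v$ and $\tilde w_{vu}$ otherwise. An assignment $\rho:\Delta\to V$ with $\rho(T)\in T$ is fixed, $\Delta_v=\rho^{-1}(v)$. Step 2: node $v$ computes $f'_v(w^v)=\sum_{T=\{v,u,x\}\in\Delta_v}\mathbf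 1\{w_{vu}+w_{vx}+w'_{ux}<\lambda\}$ (biased estimator), regarded as a function of $w^v$ with the $w'$ fixed, and releases $\tilde f_v=f'_v(w^v)+L_v$ with $L_v\sim\mathrm{Lap}(GS(f'_v)/\varepsilon_2)$ independent, where $GS(f'_v)=\max\{|f'_v(a)-f'_v(b)|:\|a-b\|_1\le1\}$. Output $\tilde k=\sum_v\tilde f_v$. For $e=\{x,y\}\in E$ let $l(e)=|\{T\in\Delta:e\subseteq T,\ \rho(T)\notin e\}|$ and $\#C'_4=\sum_{e\in E}\binom{l(e)}{2}$. *)

theory Defs
  imports "HOL-Probability.Probability"
begin

text \<open>A graph on \<open>{1..n}\<close> is given by its set \<open>E\<close> of edges. A weight function
  \<open>w :: nat \<Rightarrow> nat \<Rightarrow> int\<close> is relevant only on adjacent pairs.\<close>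

definition simple_graph :: "nat \<Rightarrow> nat set set \<Rightarrow> bool" where
  "simple_graph n E \<longleftrightarrow> (\<forall>e\<in>E. e \<subseteq> {1..n} \<and> card e = 2)"

definition nbh :: "nat set set \<Rightarrow> nat \<Rightarrow> nat set" where
  "nbh E v = {u. {v, u} \<in> E}"

text \<open>The inserted \<open>0\<close> only matters for the graph without vertices.\<close>

definition max_degree :: "nat \<Rightarrow> nat set set \<Rightarrow> nat" where
  "max_degree n E = Max (insert 0 ((\<lambda>v. card (nbh E v)) ` {1..n}))"

definition triangles :: "nat set set \<Rightarrow> nat set set" where
  "triangles E = {T. card T = 3 \<and> (\<forall>u\<in>T. \<forall>v\<in>T. u \<noteq> v \<longrightarrow> {u, v} \<in> E)}"

definition tri_weight :: "(nat \<Rightarrow> nat \<Rightarrow> int) \<Rightarrow> nat set \<Rightarrow> int" where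
  "tri_weight w T = (\<Sum>(u, v)\<in>{(u, v). u \<in> T \<and> v \<in> T \<and> u < v}. w u v)"

definition triangle_count :: "nat set set \<Rightarrow> (nat \<Rightarrow> nat \<Rightarrow> int) \<Rightarrow> int \<Rightarrow> nat" where
  "triangle_count E w lam = card {T \<in> triangles E. tri_weight w T < lam}"

definition assigned :: "nat set set \<Rightarrow> (nat set \<Rightarrow> nat) \<Rightarrow> nat \<Rightarrow> nat set set" where
  "assigned E \<rho> v = {T \<in> triangles E. \<rho> T = v}"

definition edge_load :: "nat set set \<Rightarrow> (nat set \<Rightarrow> nat) \<Rightarrow> nat set \<Rightarrow> nat" where
  "edge_load E \<rho> e = card {T \<in> triangles E. e \<subseteq> T \<and> \<rho> T \<notin> e}"

definition num_C4' :: "nat set set \<Rightarrow> (nat set \<Rightarrow> nat) \<Rightarrow> nat" where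
  "num_C4' E \<rho> = (\<Sum>e\<in>E. edge_load E \<rho> e choose 2)"

definition dlap :: "real \<Rightarrow> int pmf" where
  "dlap p = embed_pmf (\<lambda>i. (1 - p) / (1 + p) * p ^ nat \<bar>i\<bar>)"

lemma pmf_dlap:
  assumes "0 < p" "p < 1"
  shows "pmf (dlap p) i = (1 - p) / (1 + p) * p ^ nat \<bar>i\<bar>"
  unfolding dlap_def
proof (rule pmf_embed_pmf)
  let ?c = "(1 - p) / (1 + p)"
  let ?f = "\<lambda>i::int. ?c * p ^ nat \<bar>i\<bar>"
  let ?g = "\<lambda>n::nat. - int (Suc n)"
  show nonneg: "\<And>i. 0 \<le> ?f i" using assms by simp
  have un: "(UNIV :: int set) = range int \<union> range ?g"
  proof (intro set_eqI iffI)
    fix x :: int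
    show "x \<in> range int \<union> range ?g"
    proof (cases "x \<ge> 0")
      case True
      then have "x = int (nat x)" by simp
      then show ?thesis by blast
    next
      case False
      then have "x = ?g (nat (- x - 1))" by simp
      then show ?thesis by blast
    qed
  qed simp
  have dj: "range int \<inter> range ?g = {}" by auto
  have b1: "bij_betw int UNIV (range int)" by (auto simp: bij_betw_def)
  have b2: "bij_betw ?g UNIV (range ?g)" by (auto simp: bij_betw_def inj_on_def)
  have s1: "(\<lambda>n. ?c * p ^ n) sums (?c * (1 / (1 - p)))"
    using assms by (intro sums_mult geometric_sums) auto
  have s2: "(\<lambda>n. ?c * p * p ^ n) sums (?c * p * (1 / (1 - p)))"
    using assms by (intro sums_mult geometric_sums) auto
  have e1: "(\<integral>\<^sup>+ i. ?f i \<partial>count_space (range int)) = ennreal (?c * (1 / (1 - p)))"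
  proof -
    have "(\<integral>\<^sup>+ i. ?f i \<partial>count_space (range int)) = (\<integral>\<^sup>+ n. ?f (int n) \<partial>count_space UNIV)"
      by (rule nn_integral_bij_count_space[OF b1, symmetric])
    also have "\<dots> = (\<Sum>n. ennreal (?f (int n)))" by (rule nn_integral_count_space_nat)
    also have "\<dots> = ennreal (?c * (1 / (1 - p)))"
      using s1 assms by (intro suminf_ennreal_eq) auto
    finally show ?thesis .
  qed
  have e2: "(\<integral>\<^sup>+ i. ?f i \<partial>count_space (range ?g)) = ennreal (?c * p * (1 / (1 - p)))"
  proof -
    have "(\<integral>\<^sup>+ i. ?f i \<partial>count_space (range ?g)) = (\<integral>\<^sup>+ n. ?f (?g n) \<partial>count_space UNIV)"
      by (rule nn_integral_bij_count_space[OF b2, symmetric])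
    also have "\<dots> = (\<Sum>n. ennreal (?f (?g n)))" by (rule nn_integral_count_space_nat)
    also have "\<dots> = (\<Sum>n. ennreal (?c * p * p ^ n))"
    proof (rule suminf_cong)
      fix n
      have "nat \<bar>?g n\<bar> = Suc n" by (simp only: abs_minus_cancel abs_of_nat nat_int)
      then show "ennreal (?f (?g n)) = ennreal (?c * p * p ^ n)"
        by (simp only: power_Suc mult.assoc)
    qed
    also have "\<dots> = ennreal (?c * p * (1 / (1 - p)))"
      using s2 assms by (intro suminf_ennreal_eq) auto
    finally show ?thesis .
  qed
  have "(\<integral>\<^sup>+ i. ?f i \<partial>count_space UNIV) =
      (\<integral>\<^sup>+ i. ?f i \<partial>count_space (range int)) + (\<integral>\<^sup>+ i. ?f i \<partial>count_space (range ?g))"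
  proof -
    have "(\<integral>\<^sup>+ i. ?f i \<partial>count_space UNIV) =
        (\<integral>\<^sup>+ i. ennreal (?f i) * indicator (range int) i +
              ennreal (?f i) * indicator (range ?g) i \<partial>count_space UNIV)"
    proof (rule nn_integral_cong)
      fix x :: int
      consider "x \<in> range int" "x \<notin> range ?g" | "x \<notin> range int" "x \<in> range ?g"
        using un dj by blast
      then show "ennreal (?f x) =
          ennreal (?f x) * indicator (range int) x + ennreal (?f x) * indicator (range ?g) x"
        by cases (simp_all only: indicator_simps not_False_eq_True mult_1_right mult_zero_right add_0_left add_0_right)
    qed
    also have "\<dots> = (\<integral>\<^sup>+ i. ennreal (?f i) * indicator (range int) i \<partial>count_space UNIV) +
        (\<integral>\<^sup>+ i. ennreal (?f i) * indicator (range ?g) i \<partial>count_space UNIV)"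
      by (rule nn_integral_add) auto
    also have "\<dots> = (\<integral>\<^sup>+ i. ?f i \<partial>count_space (range int)) +
        (\<integral>\<^sup>+ i. ?f i \<partial>count_space (range ?g))"
      by (intro arg_cong2[where f = "(+)"] nn_integral_count_space_indicator[symmetric])
        (simp_all add: NO_MATCH_def)
    finally show ?thesis .
  qed
  also have "\<dots> = ennreal (?c * (1 / (1 - p)) + ?c * p * (1 / (1 - p)))"
    unfolding e1 e2 using assms by (intro ennreal_plus[symmetric]) auto
  also have "?c * (1 / (1 - p)) + ?c * p * (1 / (1 - p)) = 1"
    using assms by (simp add: divide_simps)
  finally show "(\<integral>\<^sup>+ i. ?f i \<partial>count_space UNIV) = 1" by simp
qed

text \<open>Scale \<open>0\<close> occurs in the algorithm when the sensitivity of a query vanishes; no noise is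
  added in that case.\<close>

definition lap :: "real \<Rightarrow> real measure" where
  "lap b = (if b = 0 then return borel 0
            else density lborel (\<lambda>y. ennreal (1 / (2 * b) * exp (- \<bar>y\<bar> / b))))"

definition arcs :: "nat set set \<Rightarrow> (nat \<times> nat) set" where
  "arcs E = {(v, u). {v, u} \<in> E}"

definition step1 ::
  "real \<Rightarrow> nat set set \<Rightarrow> (nat \<Rightarrow> nat \<Rightarrow> int) \<Rightarrow> (nat \<Rightarrow> nat \<Rightarrow> int) pmf" where
  "step1 \<epsilon>1 E w = map_pmf (\<lambda>Y v u. w v u + Y (v, u))
     (Pi_pmf (arcs E) 0 (\<lambda>_. dlap (exp (- \<epsilon>1))))"

definition noisy_weight :: "(nat \<Rightarrow> nat \<Rightarrow> int) \<Rightarrow> nat \<Rightarrow> nat \<Rightarrow> int" where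
  "noisy_weight wt u v = (if u < v then wt u v else wt v u)"

text \<open>The pairs \<open>u < x\<close> with \<open>{v, u, x}\<close> a triangle assigned to \<open>v\<close> enumerate these triangles
  without repetition; the argument \<open>a\<close> plays the role of the weight vector of \<open>v\<close>.\<close>

definition biased_est ::
  "nat set set \<Rightarrow> int \<Rightarrow> (nat set \<Rightarrow> nat) \<Rightarrow> (nat \<Rightarrow> nat \<Rightarrow> int) \<Rightarrow> nat \<Rightarrow> (nat \<Rightarrow> int) \<Rightarrow> real" where
  "biased_est E lam \<rho> w' v a =
     (\<Sum>(u, x)\<in>{(u, x). u < x \<and> {v, u, x} \<in> assigned E \<rho> v}. of_bool (a u + a x + w' u x < lam))"

text \<open>Weights are integers, so the sensitivity compares integer vectors only.\<close>

definition global_sensitivity :: "'i set \<Rightarrow> (('i \<Rightarrow> int) \<Rightarrow> real) \<Rightarrow> real" where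
  "global_sensitivity I f =
     Max {\<bar>f a - f b\<bar> | a b. a \<in> I \<rightarrow>\<^sub>E UNIV \<and> b \<in> I \<rightarrow>\<^sub>E UNIV \<and> (\<Sum>i\<in>I. \<bar>a i - b i\<bar>) \<le> 1}"

lemma finite_range_biased_est: "finite (range (biased_est E lam \<rho> w' v))"
proof -
  let ?P = "{(u, x). u < x \<and> {v, u, x} \<in> assigned E \<rho> v}"
  have "biased_est E lam \<rho> w' v a \<in> real ` {..card ?P}" for a
  proof -
    let ?N = "\<Sum>z\<in>?P. of_bool (a (fst z) + a (snd z) + w' (fst z) (snd z) < lam) :: nat"
    have "biased_est E lam \<rho> w' v a = real ?N"
      by (simp add: biased_est_def case_prod_unfold of_nat_sum)
    moreover have "?N \<le> (\<Sum>_\<in>?P. 1)" by (intro sum_mono) auto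
    then have "?N \<in> {..card ?P}" by simp
    ultimately show ?thesis by (rule image_eqI)
  qed
  then show ?thesis by (intro finite_subset[OF _ finite_imageI[OF finite_atMost]]) blast
qed

lemma finite_sensitivity_biased_est:
  "finite {\<bar>biased_est E lam \<rho> w' v a - biased_est E lam \<rho> w' v b\<bar> | a b.
     a \<in> I \<rightarrow>\<^sub>E UNIV \<and> b \<in> I \<rightarrow>\<^sub>E UNIV \<and> (\<Sum>i\<in>I. \<bar>a i - b i\<bar>) \<le> 1}"
proof (rule finite_subset)
  let ?R = "range (biased_est E lam \<rho> w' v)"
  show "finite ((\<lambda>(s, t). \<bar>s - t\<bar>) ` (?R \<times> ?R))" using finite_range_biased_est by blast
qed force

definition release ::
  "real \<Rightarrow> nat set set \<Rightarrow> (nat \<Rightarrow> nat \<Rightarrow> int) \<Rightarrow> int \<Rightarrow> (nat set \<Rightarrow> nat) \<Rightarrow> (nat \<Rightarrow> nat \<Rightarrow> int) \<Rightarrow> nat \<Rightarrow> real measure"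
  where
  "release \<epsilon>2 E w lam \<rho> w' v =
     distr (lap (global_sensitivity (nbh E v) (biased_est E lam \<rho> w' v) / \<epsilon>2)) borel
       (\<lambda>L. biased_est E lam \<rho> w' v (restrict (w v) (nbh E v)) + L)"

text \<open>The distribution of the output: conditionally on the reports of the first step, the
  releases of the nodes are independent.\<close>

definition two_step_output ::
  "real \<Rightarrow> real \<Rightarrow> nat \<Rightarrow> nat set set \<Rightarrow> (nat \<Rightarrow> nat \<Rightarrow> int) \<Rightarrow> int \<Rightarrow> (nat set \<Rightarrow> nat) \<Rightarrow> real measure" where
  "two_step_output \<epsilon>1 \<epsilon>2 n E w lam \<rho> =
     measure_pmf (step1 \<epsilon>1 E w) \<bind>
       (\<lambda>wt. distr (\<Pi>\<^sub>M v\<in>{1..n}. release \<epsilon>2 E w lam \<rho> (noisy_weight wt) v) borel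
               (\<lambda>f. \<Sum>v\<in>{1..n}. f v))"

end

theory Submission
  imports Defs
begin

text \<open>Flipping the indicator of a triangle requires nonzero noise on the edge opposite to its
  assigned vertex, so the error of the noiseless query is at most \<open>\<Sum>\<^sub>e l(e) Z\<^sub>e\<close>, where the
  independent \<open>Z\<^sub>e\<close> indicate nonzero noise and have mean \<open>q \<le> min (2/\<epsilon>\<^sub>1) (4/\<epsilon>\<^sub>1\<^sup>2)\<close>. Its second
  moment is at most \<open>q\<^sup>2 (\<Sum>l)\<^sup>2 + q \<Sum>l\<^sup>2\<close>, with \<open>\<Sum>l = |\<Delta>|\<close> and \<open>\<Sum>l\<^sup>2 = 2 #C'\<^sub>4 + |\<Delta>|\<close>. Given
  the reports, the Laplace noise adds the variance \<open>\<Sum>\<^sub>v 2 (GS\<^sub>v/\<epsilon>\<^sub>2)\<^sup>2\<close>, where \<open>GS\<^sub>v \<le> deg v\<close> because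
  integer vectors at distance at most \<open>1\<close> differ in at most one coordinate.\<close>

section \<open>Second moments of Laplace noise and of independent sums\<close>

text \<open>Folding the line at 0 turns the Laplace law into an exponential one of rate
  \<open>1 / b\<close> with a random sign, so that the known moments of exponential densities become
  available.\<close>

lemma nn_integral_lap:
  assumes b: "b > 0" and f [measurable]: "f \<in> borel_measurable borel"
  shows "(\<integral>\<^sup>+ y. f y \<partial>lap b) =
    (\<integral>\<^sup>+ y. ennreal (exponential_density (1 / b) y / 2) * (f y + f (- y)) \<partial>lborel)"
proof -
  let ?e = "\<lambda>y. ennreal (exponential_density (1 / b) y / 2)"
  have "(\<integral>\<^sup>+ y. f y \<partial>lap b) = (\<integral>\<^sup>+ y. ennreal (1 / (2 * b) * exp (- \<bar>y\<bar> / b)) * f y \<partial>lborel)"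
    using b by (simp add: lap_def nn_integral_density)
  also have "\<dots> = (\<integral>\<^sup>+ y. ?e y * f y + ?e (- y) * f y \<partial>lborel)"
  proof (rule nn_integral_cong_AE)
    \<comment> \<open>At \<open>y = 0\<close> both halves \<open>?e y\<close> and
      \<open>?e (- y)\<close> are positive and their sum counts the density twice, so equality holds
      only off this null set.\<close>
    have "AE y in lborel. y \<noteq> (0::real)" by (rule AE_lborel_singleton)
    then show "AE y in lborel. ennreal (1 / (2 * b) * exp (- \<bar>y\<bar> / b)) * f y = ?e y * f y + ?e (- y) * f y"
    proof eventually_elim
      case (elim y)
      then show ?case using b by (cases "y > 0") (auto simp: exponential_density_def mult.commute)
    qed
  qed
  also have "\<dots> = (\<integral>\<^sup>+ y. ?e y * f y \<partial>lborel) + (\<integral>\<^sup>+ y. ?e (- y) * f y \<partial>lborel)"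
    by (rule nn_integral_add) auto
  also have "(\<integral>\<^sup>+ y. ?e (- y) * f y \<partial>lborel) = (\<integral>\<^sup>+ y. ?e y * f (- y) \<partial>lborel)"
    by (subst nn_integral_real_affine[where c = "-1" and t = 0]) auto
  also have "(\<integral>\<^sup>+ y. ?e y * f y \<partial>lborel) + \<dots> = (\<integral>\<^sup>+ y. ?e y * (f y + f (- y)) \<partial>lborel)"
    by (subst nn_integral_add[symmetric]) (auto simp: distrib_left)
  finally show ?thesis .
qed

lemma sets_lap [simp, measurable_cong]: "sets (lap b) = sets borel"
  by (simp add: lap_def)

lemma prob_space_lap:
  assumes "b \<ge> 0"
  shows "prob_space (lap b)"
proof (cases "b = 0")
  case True
  then show ?thesis by (simp add: lap_def prob_space_return)
next
  case False
  with assms have b: "b > 0" by simp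
  have "emeasure (lap b) (space (lap b)) = (\<integral>\<^sup>+ y. 1 \<partial>lap b)" by simp
  also have "\<dots> = (\<integral>\<^sup>+ y. ennreal (exponential_density (1 / b) y / 2) * (1 + 1) \<partial>lborel)"
    using b by (subst nn_integral_lap) auto
  \<comment> \<open>The factor \<open>y ^ 0\<close> presents the total mass as a zeroth moment of
    the exponential density.\<close>
  also have "\<dots> = (\<integral>\<^sup>+ y. ennreal (exponential_density (1 / b) y * y ^ 0) \<partial>lborel)"
    using b by (intro nn_integral_cong)
      (simp add: ennreal_mult'[symmetric] flip: ennreal_numeral ennreal_1 ennreal_plus)
  also have "\<dots> = 1" using b by (subst nn_integral_erlang_ith_moment) auto
  finally show ?thesis by (rule prob_spaceI)
qed

text \<open>After folding, the cross terms of the squares around \<open>c\<close> and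
  \<open>- c\<close> cancel; what remains is \<open>c\<^sup>2\<close> plus the second moment
  \<open>2 * b\<^sup>2\<close> of the exponential law. Scale 0 is the point mass at 0 and fits the
  same formula.\<close>

lemma nn_integral_lap_square:
  assumes "b \<ge> 0"
  shows "(\<integral>\<^sup>+ y. ennreal ((y - c)\<^sup>2) \<partial>lap b) = ennreal (c\<^sup>2 + 2 * b\<^sup>2)"
proof (cases "b = 0")
  case True
  then show ?thesis by (simp add: lap_def nn_integral_return)
next
  case False
  with assms have b: "b > 0" by simp
  let ?e = "exponential_density (1 / b)"
  have "(\<integral>\<^sup>+ y. ennreal ((y - c)\<^sup>2) \<partial>lap b) =
      (\<integral>\<^sup>+ y. ennreal (?e y / 2) * (ennreal ((y - c)\<^sup>2) + ennreal ((- y - c)\<^sup>2)) \<partial>lborel)"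
    using b by (intro nn_integral_lap) auto
  also have "\<dots> = (\<integral>\<^sup>+ y. ennreal (?e y * y ^ 2) + ennreal (c\<^sup>2) * ennreal (?e y * y ^ 0) \<partial>lborel)"
  proof (rule nn_integral_cong)
    fix y :: real
    have "ennreal (?e y / 2) * (ennreal ((y - c)\<^sup>2) + ennreal ((- y - c)\<^sup>2)) =
        ennreal (?e y / 2 * ((y - c)\<^sup>2 + (- y - c)\<^sup>2))"
      using b by (subst ennreal_mult) auto
    also have "?e y / 2 * ((y - c)\<^sup>2 + (- y - c)\<^sup>2) = ?e y * y ^ 2 + c\<^sup>2 * (?e y * y ^ 0)"
      by (simp add: power2_eq_square algebra_simps)
    also have "ennreal \<dots> = ennreal (?e y * y ^ 2) + ennreal (c\<^sup>2) * ennreal (?e y * y ^ 0)"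
      using b by (subst ennreal_plus) (auto simp: ennreal_mult')
    finally show "ennreal (?e y / 2) * (ennreal ((y - c)\<^sup>2) + ennreal ((- y - c)\<^sup>2)) = \<dots>" .
  qed
  also have "\<dots> = (\<integral>\<^sup>+ y. ennreal (?e y * y ^ 2) \<partial>lborel) +
      ennreal (c\<^sup>2) * (\<integral>\<^sup>+ y. ennreal (?e y * y ^ 0) \<partial>lborel)"
    by (subst nn_integral_add) (auto simp: nn_integral_cmult)
  also have "\<dots> = ennreal (2 * b\<^sup>2) + ennreal (c\<^sup>2)"
    using b by (subst (1 2) nn_integral_erlang_ith_moment)
      (auto simp: power_divide numeral_2_eq_2)
  also have "\<dots> = ennreal (c\<^sup>2 + 2 * b\<^sup>2)"
    by (simp add: add.commute flip: ennreal_plus)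
  finally show ?thesis .
qed

text \<open>Assumption \<open>mom\<close>, taken for all \<open>c\<close>, says that
  \<open>M i\<close> has mean \<open>\<mu> i\<close> and variance at most \<open>s i\<close>,
  without mentioning signed integrals. In the induction the coordinate \<open>y\<close> of
  \<open>i\<close> is integrated last: the other coordinates see the shifted centre
  \<open>c - y\<close>, which is why \<open>c\<close> must be arbitrary.\<close>

lemma nn_integral_PiM_sum_square_le:
  fixes M :: "'i \<Rightarrow> real measure"
  assumes "finite I"
    and prob: "\<And>i. prob_space (M i)" and sets_M: "\<And>i. sets (M i) = sets borel"
    and mom: "\<And>i c. (\<integral>\<^sup>+ y. ennreal ((y - c)\<^sup>2) \<partial>M i) \<le> ennreal ((\<mu> i - c)\<^sup>2 + s i)"
    and s: "\<And>i. s i \<ge> 0"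
  shows "(\<integral>\<^sup>+ x. ennreal (((\<Sum>i\<in>I. x i) - c)\<^sup>2) \<partial>PiM I M) \<le>
    ennreal (((\<Sum>i\<in>I. \<mu> i) - c)\<^sup>2 + (\<Sum>i\<in>I. s i))"
  using \<open>finite I\<close>
proof (induction I arbitrary: c)
  case empty
  show ?case by (simp add: PiM_empty nn_integral_count_space_finite)
next
  case (insert i I)
  interpret product_prob_space M
    by (intro product_prob_spaceI prob)
  note [measurable_cong] = sets_M
  let ?m = "\<Sum>j\<in>I. \<mu> j" and ?S = "\<Sum>j\<in>I. s j"
  have S: "?S \<ge> 0" using s by (intro sum_nonneg) auto
  have upd: "(\<Sum>j\<in>insert i I. (x(i := y)) j) = y + (\<Sum>j\<in>I. x j)" for x :: "'i \<Rightarrow> real" and y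
    using insert.hyps by (subst sum.insert) (auto intro!: sum.cong)
  have "(\<integral>\<^sup>+ x. ennreal (((\<Sum>j\<in>insert i I. x j) - c)\<^sup>2) \<partial>PiM (insert i I) M) =
      (\<integral>\<^sup>+ y. \<integral>\<^sup>+ x. ennreal (((\<Sum>j\<in>insert i I. (x(i := y)) j) - c)\<^sup>2) \<partial>PiM I M \<partial>M i)"
    using insert.hyps by (intro product_nn_integral_insert_rev) measurable
  also have "\<dots> = (\<integral>\<^sup>+ y. \<integral>\<^sup>+ x. ennreal (((\<Sum>j\<in>I. x j) - (c - y))\<^sup>2) \<partial>PiM I M \<partial>M i)"
    unfolding upd by (simp add: algebra_simps)
  also have "\<dots> \<le> (\<integral>\<^sup>+ y. ennreal ((?m - (c - y))\<^sup>2 + ?S) \<partial>M i)"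
    by (intro nn_integral_mono insert.IH)
  also have "\<dots> = (\<integral>\<^sup>+ y. ennreal ((y - (c - ?m))\<^sup>2) + ennreal ?S \<partial>M i)"
    using S by (intro nn_integral_cong) (simp add: algebra_simps)
  also have "\<dots> = (\<integral>\<^sup>+ y. ennreal ((y - (c - ?m))\<^sup>2) \<partial>M i) + ennreal ?S"
    by (subst nn_integral_add) (auto simp: prob_space.emeasure_space_1[OF prob])
  also have "\<dots> \<le> ennreal ((\<mu> i - (c - ?m))\<^sup>2 + s i) + ennreal ?S"
    by (intro add_right_mono mom)
  also have "\<dots> = ennreal (((\<Sum>j\<in>insert i I. \<mu> j) - c)\<^sup>2 + (\<Sum>j\<in>insert i I. s j))"
    using insert.hyps S s by (subst ennreal_plus[symmetric]) (auto simp: algebra_simps)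
  finally show ?case .
qed

section \<open>Finiteness and degree sums\<close>

lemma finite_edges:
  assumes "simple_graph n E"
  shows "finite E"
  by (rule finite_subset[of _ "Pow {1..n}"]) (use assms in \<open>auto simp: simple_graph_def\<close>)

lemma nbh_subset:
  assumes "simple_graph n E"
  shows "nbh E v \<subseteq> {1..n}"
  using assms by (auto simp: simple_graph_def nbh_def)

lemma triangle_subset:
  assumes "simple_graph n E" "T \<in> triangles E"
  shows "T \<subseteq> {1..n}"
proof
  fix u assume u: "u \<in> T"
  have "\<exists>v\<in>T. v \<noteq> u"
  proof (rule ccontr)
    assume "\<not> ?thesis"
    then have "T \<subseteq> {u}" by auto
    then have "card T \<le> card {u}" by (intro card_mono) auto
    then show False using assms(2) by (simp add: triangles_def)
  qed
  then obtain v where "v \<in> T" "u \<noteq> v" by auto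
  then have "{u, v} \<in> E" using u assms(2) by (auto simp: triangles_def)
  then show "u \<in> {1..n}" using assms(1) by (auto simp: simple_graph_def)
qed

lemma finite_triangles:
  assumes "simple_graph n E"
  shows "finite (triangles E)"
  by (rule finite_subset[of _ "Pow {1..n}"]) (use triangle_subset[OF assms] in auto)

lemma finite_arcs:
  assumes "simple_graph n E"
  shows "finite (arcs E)"
  by (rule finite_subset[of _ "{1..n} \<times> {1..n}"])
    (use assms in \<open>auto simp: simple_graph_def arcs_def\<close>)

text \<open>Handshake argument: the map from \<open>u\<close> to \<open>{v, u}\<close> sends
  neighbours of \<open>v\<close> injectively to edges at \<open>v\<close>, and every edge is counted
  at its two endpoints.\<close>

lemma sum_degree_le:
  assumes "simple_graph n E"
  shows "(\<Sum>v\<in>{1..n}. card (nbh E v)) \<le> 2 * card E"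
proof -
  note fin = finite_edges[OF assms]
  have "card (nbh E v) \<le> card {e \<in> E. v \<in> e}" for v
    by (rule card_inj_on_le[of "\<lambda>u. {v, u}"])
      (use fin in \<open>auto simp: inj_on_def nbh_def doubleton_eq_iff\<close>)
  then have "(\<Sum>v\<in>{1..n}. card (nbh E v)) \<le> (\<Sum>v\<in>{1..n}. card {e \<in> E. v \<in> e})"
    by (rule sum_mono)
  also have "\<dots> = 2 * card E"
  proof (rule sum_multicount)
    show "\<forall>e\<in>E. card {v \<in> {1..n}. v \<in> e} = 2"
    proof
      fix e assume "e \<in> E"
      then have "e \<subseteq> {1..n}" "card e = 2" using assms by (auto simp: simple_graph_def)
      moreover from this(1) have "{v \<in> {1..n}. v \<in> e} = e" by auto
      ultimately show "card {v \<in> {1..n}. v \<in> e} = 2" by simp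
    qed
  qed (use fin in auto)
  finally show ?thesis .
qed

lemma sum_degree_square_le:
  assumes "simple_graph n E"
  shows "(\<Sum>v\<in>{1..n}. (real (card (nbh E v)))\<^sup>2) \<le> 2 * real (max_degree n E) * real (card E)"
proof -
  have "(\<Sum>v\<in>{1..n}. (card (nbh E v))\<^sup>2) \<le> (\<Sum>v\<in>{1..n}. max_degree n E * card (nbh E v))"
    unfolding power2_eq_square max_degree_def by (intro sum_mono mult_right_mono Max_ge) auto
  also have "\<dots> \<le> max_degree n E * (2 * card E)"
    using sum_degree_le[OF assms] by (simp flip: sum_distrib_left)
  finally have "real (\<Sum>v\<in>{1..n}. (card (nbh E v))\<^sup>2) \<le> real (max_degree n E * (2 * card E))"
    by (rule of_nat_mono)
  then show ?thesis by simp
qed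

section \<open>Sensitivity of the biased estimator and the noise of a release\<close>

text \<open>If \<open>a\<close> and \<open>b\<close> differ at the single coordinate
  \<open>i\<close>, only indicators of pairs containing \<open>i\<close> can change, each by at most
  1. Such a pair is determined by its other member, a neighbour of \<open>v\<close>.\<close>

lemma biased_est_diff_le:
  assumes fin: "finite (nbh E v)"
    and ab: "(\<Sum>i\<in>nbh E v. \<bar>a i - b i\<bar>) \<le> (1::int)"
  shows "\<bar>biased_est E lam \<rho> w' v a - biased_est E lam \<rho> w' v b\<bar> \<le> real (card (nbh E v))"
proof -
  let ?N = "nbh E v"
  let ?P = "{(u, x). u < x \<and> {v, u, x} \<in> assigned E \<rho> v}"
  let ?g = "\<lambda>a (u, x). of_bool (a u + a x + w' u x < lam) :: real"
  have PN: "u \<in> ?N \<and> x \<in> ?N" if "(u, x) \<in> ?P" for u x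
  proof -
    from that have "card {v, u, x} = 3" "u < x"
      and E: "\<forall>s\<in>{v, u, x}. \<forall>t\<in>{v, u, x}. s \<noteq> t \<longrightarrow> {s, t} \<in> E"
      by (auto simp: assigned_def triangles_def)
    then have "v \<noteq> u" "v \<noteq> x" by (auto simp: card_insert_if split: if_splits)
    then show ?thesis using E by (simp add: nbh_def)
  qed
  have finP: "finite ?P"
    by (rule finite_subset[of _ "?N \<times> ?N"]) (use PN fin in auto)
  have diff: "biased_est E lam \<rho> w' v a - biased_est E lam \<rho> w' v b = (\<Sum>z\<in>?P. ?g a z - ?g b z)"
    by (simp add: biased_est_def sum_subtractf case_prod_unfold)
  show ?thesis
  proof (cases "\<forall>i\<in>?N. a i = b i")
    case True
    then have "(\<Sum>z\<in>?P. ?g a z - ?g b z) = 0"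
      by (intro sum.neutral) (use PN in fastforce)
    then show ?thesis unfolding diff by simp
  next
    case False
    then obtain i where i: "i \<in> ?N" "a i \<noteq> b i" by auto
    \<comment> \<open>Two differing integer coordinates would already contribute at least 2 to the
      distance.\<close>
    have eq: "a j = b j" if "j \<in> ?N" "j \<noteq> i" for j
    proof (rule ccontr)
      assume "a j \<noteq> b j"
      have "(\<Sum>k\<in>{i, j}. \<bar>a k - b k\<bar>) \<le> (\<Sum>k\<in>?N. \<bar>a k - b k\<bar>)"
        using i that fin by (intro sum_mono2) auto
      then show False using ab i that \<open>a j \<noteq> b j\<close> by simp
    qed
    \<comment> \<open>All increasing pairs through \<open>i\<close>, as an image of the
      neighbourhood, so that its size is at most the degree; the extra pair \<open>(i, i)\<close>
      does no harm.\<close>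
    let ?Q = "(\<lambda>z. (min i z, max i z)) ` ?N"
    have "\<bar>\<Sum>z\<in>?P. ?g a z - ?g b z\<bar> \<le> (\<Sum>z\<in>?P. of_bool (z \<in> ?Q))"
    proof (rule order_trans[OF sum_abs], rule sum_mono)
      fix z assume "z \<in> ?P"
      then obtain u x where z: "z = (u, x)" and "u < x" and N: "u \<in> ?N" "x \<in> ?N"
        using PN by auto
      show "\<bar>?g a z - ?g b z\<bar> \<le> of_bool (z \<in> ?Q)"
      proof (cases "u = i \<or> x = i")
        case True
        then have "(u, x) = (min i x, max i x) \<or> (u, x) = (min i u, max i u)"
          using \<open>u < x\<close> by auto
        then have "z \<in> ?Q" unfolding z using N by blast
        then show ?thesis by (simp add: z)
      next
        case False
        then show ?thesis using eq N by (simp add: z)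
      qed
    qed
    also have "\<dots> = real (card (?P \<inter> ?Q))"
      using finP by (simp add: of_bool_def flip: sum.inter_restrict)
    also have "card (?P \<inter> ?Q) \<le> card ?Q" using fin by (intro card_mono) auto
    also have "card ?Q \<le> card ?N" using fin by (rule card_image_le)
    finally show ?thesis unfolding diff by simp
  qed
qed

lemma global_sensitivity_bounds:
  assumes "finite (nbh E v)"
  shows "0 \<le> global_sensitivity (nbh E v) (biased_est E lam \<rho> w' v)"
    and "global_sensitivity (nbh E v) (biased_est E lam \<rho> w' v) \<le> real (card (nbh E v))"
proof -
  let ?I = "nbh E v" and ?f = "biased_est E lam \<rho> w' v"
  let ?S = "{\<bar>?f a - ?f b\<bar> | a b. a \<in> ?I \<rightarrow>\<^sub>E UNIV \<and> b \<in> ?I \<rightarrow>\<^sub>E UNIV \<and> (\<Sum>i\<in>?I. \<bar>a i - b i\<bar>) \<le> 1}"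
  have fin: "finite ?S" by (rule finite_sensitivity_biased_est)
  \<comment> \<open>Comparing one vector with itself puts 0 into the set, which gives both
    nonemptiness for \<open>Max\<close> and the lower bound.\<close>
  let ?a = "restrict (\<lambda>_. 0::int) ?I"
  have "\<bar>?f ?a - ?f ?a\<bar> \<in> ?S" by (intro CollectI exI[of _ ?a]) auto
  then have "0 \<in> ?S" by simp
  with fin show "0 \<le> global_sensitivity ?I ?f"
    unfolding global_sensitivity_def by (rule Max_ge)
  show "global_sensitivity ?I ?f \<le> real (card ?I)"
    unfolding global_sensitivity_def
    using fin \<open>0 \<in> ?S\<close> biased_est_diff_le[OF assms] by (subst Max_le_iff) auto
qed

lemma prob_space_release:
  assumes "simple_graph n E" "\<epsilon>2 > 0"
  shows "prob_space (release \<epsilon>2 E w lam \<rho> w' v)"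
  unfolding release_def
  using assms global_sensitivity_bounds(1)[of E v] nbh_subset[OF assms(1), THEN finite_subset]
  by (intro prob_space.prob_space_distr prob_space_lap) auto

text \<open>A release is Laplace noise shifted by the estimate, so its moment around
  \<open>c\<close> is a Laplace moment around a shifted centre. Replacing the sensitivity by the
  degree makes the variance term independent of the reports \<open>w'\<close>.\<close>

lemma nn_integral_release_square:
  assumes "simple_graph n E" "\<epsilon>2 > 0"
  shows "(\<integral>\<^sup>+ y. ennreal ((y - c)\<^sup>2) \<partial>release \<epsilon>2 E w lam \<rho> w' v) \<le>
    ennreal ((biased_est E lam \<rho> w' v (restrict (w v) (nbh E v)) - c)\<^sup>2
             + 2 * (real (card (nbh E v)) / \<epsilon>2)\<^sup>2)"
proof -
  have fin: "finite (nbh E v)" using nbh_subset[OF assms(1)] by (rule finite_subset) simp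
  note GS = global_sensitivity_bounds[OF fin, of lam \<rho> w']
  let ?b = "global_sensitivity (nbh E v) (biased_est E lam \<rho> w' v) / \<epsilon>2"
  let ?\<mu> = "biased_est E lam \<rho> w' v (restrict (w v) (nbh E v))"
  have b: "?b \<ge> 0" using GS(1) assms(2) by simp
  have "(\<integral>\<^sup>+ y. ennreal ((y - c)\<^sup>2) \<partial>release \<epsilon>2 E w lam \<rho> w' v) =
      (\<integral>\<^sup>+ y. ennreal ((y - (c - ?\<mu>))\<^sup>2) \<partial>lap ?b)"
    unfolding release_def by (subst nn_integral_distr) (auto simp: algebra_simps)
  also have "\<dots> = ennreal ((c - ?\<mu>)\<^sup>2 + 2 * ?b\<^sup>2)" by (rule nn_integral_lap_square[OF b])
  also have "\<dots> \<le> ennreal ((?\<mu> - c)\<^sup>2 + 2 * (real (card (nbh E v)) / \<epsilon>2)\<^sup>2)"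
    using GS assms(2) b unfolding power2_commute[of c]
    by (intro ennreal_leI add_left_mono mult_left_mono power_mono divide_right_mono) auto
  finally show ?thesis .
qed

section \<open>Triangles, opposite edges and their loads\<close>

text \<open>\<open>noisy_weight\<close> uses the report of the smaller endpoint; this arc is
  therefore the index of the one noise variable that enters the weight of the edge.\<close>

definition edge_arc :: "nat set \<Rightarrow> nat \<times> nat" where
  "edge_arc e = (Min e, Max e)"

lemma edge_arc_doubleton: "u < x \<Longrightarrow> edge_arc {u, x} = (u, x)"
  by (simp add: edge_arc_def)

lemma card_2_ordered:
  fixes e :: "nat set"
  assumes "card e = 2"
  obtains u x where "u < x" "e = {u, x}"
proof -
  from assms obtain u x where ux: "e = {u, x}" "u \<noteq> x" by (auto simp: card_2_iff)
  then consider "u < x" | "x < u" by linarith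
  then show thesis using ux that by cases (auto simp: insert_commute)
qed

text \<open>Distinct edges read distinct noise variables; this is what makes their noise
  independent.\<close>

lemma edge_arc_inj_on:
  assumes "simple_graph n E"
  shows "inj_on edge_arc E"
proof (rule inj_onI)
  fix e e' assume e: "e \<in> E" "e' \<in> E" "edge_arc e = edge_arc e'"
  then have "card e = 2" "card e' = 2" using assms by (auto simp: simple_graph_def)
  then show "e = e'" using e(3) by (auto elim!: card_2_ordered simp: edge_arc_doubleton)
qed

lemma edge_arc_in_arcs:
  assumes "simple_graph n E" "e \<in> E"
  shows "edge_arc e \<in> arcs E"
proof -
  have "card e = 2" using assms by (auto simp: simple_graph_def)
  then show ?thesis using assms(2) by (auto elim!: card_2_ordered simp: edge_arc_doubleton arcs_def)
qed

text \<open>\<open>tri_weight\<close> sums over increasing pairs, so the position of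
  \<open>v\<close> relative to \<open>u < x\<close> decides which entries occur; symmetry brings
  them into row \<open>v\<close>.\<close>

lemma tri_weight_triple:
  assumes "v \<noteq> u" "v \<noteq> x" "u < x" "w u v = w v u" "w x v = w v x"
  shows "tri_weight w {v, u, x} = w v u + w v x + w u x"
proof -
  let ?S = "{(a, b). a \<in> {v, u, x} \<and> b \<in> {v, u, x} \<and> a < b}"
  consider "v < u" | "u < v" "v < x" | "x < v" using assms by linarith
  then show ?thesis
  proof cases
    case 1
    then have "?S = {(v, u), (v, x), (u, x)}" using assms by auto
    then show ?thesis unfolding tri_weight_def using assms 1 by simp
  next
    case 2
    then have "?S = {(u, v), (v, x), (u, x)}" using assms by auto
    then show ?thesis unfolding tri_weight_def using assms 2 by simp
  next
    case 3
    then have "?S = {(u, v), (x, v), (u, x)}" using assms by auto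
    then show ?thesis unfolding tri_weight_def using assms 3 by simp
  qed
qed

locale assigned_graph =
  fixes n :: nat and E :: "nat set set" and w :: "nat \<Rightarrow> nat \<Rightarrow> int" and \<rho> :: "nat set \<Rightarrow> nat"
  assumes graph: "simple_graph n E"
    and sym: "\<And>u v. {u, v} \<in> E \<Longrightarrow> w u v = w v u"
    and rho: "\<And>T. T \<in> triangles E \<Longrightarrow> \<rho> T \<in> T"
begin

text \<open>The edge of a triangle that its assigned vertex knows only through a noisy report.\<close>

definition opp :: "nat set \<Rightarrow> nat set" where
  "opp T = T - {\<rho> T}"

text \<open>Normal form of a triangle: its assigned vertex, followed by the opposite edge in the
  increasing order that \<open>biased_est\<close> enumerates.\<close>

lemma triangle_cases:
  assumes "T \<in> triangles E"
  obtains u x where "u < x" "\<rho> T \<noteq> u" "\<rho> T \<noteq> x" "T = {\<rho> T, u, x}" "opp T = {u, x}"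
    "{\<rho> T, u} \<in> E" "{\<rho> T, x} \<in> E" "{u, x} \<in> E"
proof -
  have T: "card T = 3" "\<rho> T \<in> T" and E: "\<forall>a\<in>T. \<forall>b\<in>T. a \<noteq> b \<longrightarrow> {a, b} \<in> E"
    using assms rho by (auto simp: triangles_def)
  then have "card (opp T) = 2" by (simp add: opp_def)
  then obtain u x where ux: "u < x" "opp T = {u, x}" by (rule card_2_ordered)
  have ne: "\<rho> T \<noteq> u" "\<rho> T \<noteq> x" using ux(2) by (auto simp: opp_def)
  have eq: "T = {\<rho> T, u, x}" using T(2) ux(2) by (auto simp: opp_def)
  show thesis
  proof (rule that[OF ux(1) ne eq ux(2)])
    have "u \<in> T" "x \<in> T" using eq by blast+
    then show "{\<rho> T, u} \<in> E" "{\<rho> T, x} \<in> E" "{u, x} \<in> E" using E T(2) ne ux(1) by auto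
  qed
qed

text \<open>Node \<open>v\<close> knows its own two edge weights exactly, so the tested sum is the
  true triangle weight plus the noise on the opposite edge. The restriction to the neighbourhood is
  harmless because \<open>u\<close> and \<open>x\<close> are neighbours of \<open>v\<close>.\<close>

lemma biased_est_eq:
  "biased_est E lam \<rho> (noisy_weight (\<lambda>v u. w v u + Y (v, u))) v (restrict (w v) (nbh E v)) =
   (\<Sum>T\<in>assigned E \<rho> v. of_bool (tri_weight w T + Y (edge_arc (opp T)) < lam))"
  unfolding biased_est_def
\<comment> \<open>Adding \<open>v\<close> to a pair and taking the ordered opposite edge of a
  triangle are mutually inverse.\<close>
proof (rule sum.reindex_bij_witness[where i = "\<lambda>T. edge_arc (opp T)" and j = "\<lambda>(u, x). {v, u, x}"])
  fix z assume z: "z \<in> {(u, x). u < x \<and> {v, u, x} \<in> assigned E \<rho> v}"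
  then obtain u x where ux: "z = (u, x)" "u < x" and T: "{v, u, x} \<in> triangles E"
    and r: "\<rho> {v, u, x} = v" by (auto simp: assigned_def)
  have "card {v, u, x} = 3" using T by (simp add: triangles_def)
  then have ne: "v \<noteq> u" "v \<noteq> x" by (auto simp: card_insert_if split: if_splits)
  have opp: "opp {v, u, x} = {u, x}" using ne by (auto simp: opp_def r)
  show "edge_arc (opp (case z of (u, x) \<Rightarrow> {v, u, x})) = z"
    using ux by (simp add: opp edge_arc_doubleton)
  show "(case z of (u, x) \<Rightarrow> {v, u, x}) \<in> assigned E \<rho> v" using z by auto
  have E: "{v, u} \<in> E" "{v, x} \<in> E" using T ne by (auto simp: triangles_def)
  then have "tri_weight w {v, u, x} = w v u + w v x + w u x"
    using ne ux(2) sym[of u v] sym[of x v]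
    by (intro tri_weight_triple) (auto simp: insert_commute)
  with E show "of_bool (tri_weight w (case z of (u, x) \<Rightarrow> {v, u, x})
        + Y (edge_arc (opp (case z of (u, x) \<Rightarrow> {v, u, x}))) < lam) =
      (case z of (u, x) \<Rightarrow> of_bool (restrict (w v) (nbh E v) u + restrict (w v) (nbh E v) x
        + noisy_weight (\<lambda>v u. w v u + Y (v, u)) u x < lam))"
    using ux by (simp add: opp edge_arc_doubleton noisy_weight_def nbh_def add.assoc)
next
  fix T assume T: "T \<in> assigned E \<rho> v"
  then have tri: "T \<in> triangles E" and v: "\<rho> T = v" by (auto simp: assigned_def)
  from tri obtain u x where "u < x" "T = {\<rho> T, u, x}" "opp T = {u, x}" by (rule triangle_cases)
  with T v show "(case edge_arc (opp T) of (u, x) \<Rightarrow> {v, u, x}) = T"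
    and "edge_arc (opp T) \<in> {(u, x). u < x \<and> {v, u, x} \<in> assigned E \<rho> v}"
    by (simp_all add: edge_arc_doubleton)
qed

text \<open>The sets \<open>assigned E \<rho> v\<close> partition the triangles.\<close>

lemma sum_biased_est_eq:
  "(\<Sum>v\<in>{1..n}. biased_est E lam \<rho> (noisy_weight (\<lambda>v u. w v u + Y (v, u))) v
      (restrict (w v) (nbh E v))) =
   (\<Sum>T\<in>triangles E. of_bool (tri_weight w T + Y (edge_arc (opp T)) < lam))"
  unfolding biased_est_eq assigned_def
  using rho triangle_subset[OF graph] by (intro sum.group finite_triangles[OF graph]) blast+

text \<open>Double counting: the load of \<open>e\<close> is the number of triangles with opposite
  edge \<open>e\<close>. It transfers sums over triangles to sums over edges, whose noise variables
  are independent.\<close>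

lemma sum_opp:
  fixes g :: "nat set \<Rightarrow> real"
  shows "(\<Sum>T\<in>triangles E. g (opp T)) = (\<Sum>e\<in>E. real (edge_load E \<rho> e) * g e)"
proof -
  have "{T \<in> triangles E. opp T = e} = {T \<in> triangles E. e \<subseteq> T \<and> \<rho> T \<notin> e}" if "e \<in> E" for e
  proof (intro Collect_cong conj_cong refl iffI)
    fix T assume T: "T \<in> triangles E" and e: "e \<subseteq> T \<and> \<rho> T \<notin> e"
    from T obtain u x where "u < x" "opp T = {u, x}" by (rule triangle_cases)
    moreover have "card e = 2" using that graph by (auto simp: simple_graph_def)
    moreover have "e \<subseteq> opp T" using e by (auto simp: opp_def)
    \<comment> \<open>Both sets have two elements, so inclusion forces equality.\<close>
    ultimately show "opp T = e" by (intro card_subset_eq[symmetric]) auto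
  qed (auto simp: opp_def)
  then have "real (edge_load E \<rho> e) * g e = (\<Sum>T\<in>{T \<in> triangles E. opp T = e}. g e)" if "e \<in> E" for e
    using that by (simp add: edge_load_def)
  then have "(\<Sum>e\<in>E. real (edge_load E \<rho> e) * g e) =
      (\<Sum>e\<in>E. \<Sum>T\<in>{T \<in> triangles E. opp T = e}. g (opp T))"
    by (intro sum.cong refl) (simp del: sum_constant)
  also have "\<dots> = (\<Sum>T\<in>triangles E. g (opp T))"
    by (intro sum.group finite_triangles[OF graph] finite_edges[OF graph])
      (auto elim: triangle_cases)
  finally show ?thesis ..
qed

lemma sum_edge_load: "(\<Sum>e\<in>E. real (edge_load E \<rho> e)) = real (card (triangles E))"
  using sum_opp[of "\<lambda>_. 1"] by simp

lemma count_error_le: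
  "\<bar>(\<Sum>T\<in>triangles E. of_bool (tri_weight w T + Y (edge_arc (opp T)) < lam))
      - real (triangle_count E w lam)\<bar> \<le>
   (\<Sum>e\<in>E. real (edge_load E \<rho> e) * of_bool (Y (edge_arc e) \<noteq> 0))"
proof -
  have "real (triangle_count E w lam) = (\<Sum>T\<in>triangles E. of_bool (tri_weight w T < lam))"
    unfolding triangle_count_def using finite_triangles[OF graph]
    by (simp add: of_bool_def flip: sum.inter_filter)
  then have "\<bar>(\<Sum>T\<in>triangles E. of_bool (tri_weight w T + Y (edge_arc (opp T)) < lam))
      - real (triangle_count E w lam)\<bar> =
    \<bar>\<Sum>T\<in>triangles E. of_bool (tri_weight w T + Y (edge_arc (opp T)) < lam)
      - of_bool (tri_weight w T < lam)\<bar>"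
    by (simp add: sum_subtractf)
  \<comment> \<open>The two indicators agree when the noise vanishes and differ by at most 1
    otherwise.\<close>
  also have "\<dots> \<le> (\<Sum>T\<in>triangles E. of_bool (Y (edge_arc (opp T)) \<noteq> 0))"
    by (rule order_trans[OF sum_abs]) (rule sum_mono, simp)
  also have "\<dots> = (\<Sum>e\<in>E. real (edge_load E \<rho> e) * of_bool (Y (edge_arc e) \<noteq> 0))"
    by (rule sum_opp)
  finally show ?thesis .
qed

lemma sum_edge_load_square:
  "(\<Sum>e\<in>E. (real (edge_load E \<rho> e))\<^sup>2) = 2 * real (num_C4' E \<rho>) + real (card (triangles E))"
proof -
  have sq: "l\<^sup>2 = 2 * (l choose 2) + l" for l :: nat
    by (induction l) (auto simp: numeral_2_eq_2 algebra_simps)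
  have "(real (edge_load E \<rho> e))\<^sup>2 = 2 * real (edge_load E \<rho> e choose 2) + real (edge_load E \<rho> e)" for e
    using arg_cong[OF sq[of "edge_load E \<rho> e"], of real] by simp
  then show ?thesis
    by (simp add: sum.distrib num_C4'_def sum_edge_load flip: sum_distrib_left)
qed

end

section \<open>Second moment of the noisy load\<close>

text \<open>Expanding the square gives joint probabilities of nonzero noise:
  \<open>q\<^sup>2\<close> for distinct indices by independence, \<open>q\<close> on the diagonal.
  Bounding both by \<open>q\<^sup>2\<close> plus a diagonal \<open>q\<close> lets the first part sum
  to a perfect square.\<close>

lemma expectation_square_Pi_pmf_le:
  fixes l :: "'e \<Rightarrow> real" and p :: "int pmf"
  assumes fin: "finite A" "finite I" and inj: "inj_on k I" and sub: "k ` I \<subseteq> A"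
    and l: "\<And>e. l e \<ge> 0" and q: "q = measure_pmf.prob p {y. y \<noteq> 0}"
  shows "measure_pmf.expectation (Pi_pmf A 0 (\<lambda>_. p)) (\<lambda>Y. (\<Sum>e\<in>I. l e * of_bool (Y (k e) \<noteq> 0))\<^sup>2)
    \<le> q\<^sup>2 * (\<Sum>e\<in>I. l e)\<^sup>2 + q * (\<Sum>e\<in>I. (l e)\<^sup>2)"
proof -
  let ?M = "measure_pmf (Pi_pmf A 0 (\<lambda>_. p))"
  let ?B = "\<lambda>e e'. {Y :: 'a \<Rightarrow> int. Y (k e) \<noteq> 0 \<and> Y (k e') \<noteq> 0}"
  have q0: "q \<ge> 0" by (simp add: q)
  have prob: "measure ?M (?B e e') \<le> q\<^sup>2 + of_bool (e = e') * q" if "e \<in> I" "e' \<in> I" for e e'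
  proof -
    let ?K = "{k e, k e'}"
    have K: "?K \<subseteq> A" using that sub by auto
    \<comment> \<open>The event constrains each coordinate separately, so its probability under the
      product factors.\<close>
    have "?B e e' = Pi A (\<lambda>a. if a \<in> ?K then {y. y \<noteq> 0} else UNIV)"
      using K by (auto simp: Pi_def)
    then have "measure ?M (?B e e') =
        (\<Prod>a\<in>A. measure_pmf.prob p (if a \<in> ?K then {y. y \<noteq> 0} else UNIV))"
      using fin(1) by (simp only: measure_Pi_pmf_Pi)
    also have "\<dots> = (\<Prod>a\<in>A. if a \<in> ?K then q else 1)"
      by (intro prod.cong) (simp_all add: q)
    also have "\<dots> = (\<Prod>a\<in>A \<inter> ?K. q)"
      using fin(1) by (rule prod.inter_restrict[symmetric])
    also have "\<dots> = q ^ card ?K" using K by (simp add: Int_absorb1)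
    also have "\<dots> \<le> q\<^sup>2 + of_bool (e = e') * q"
      using that inj q0 by (cases "e = e'") (auto simp: inj_on_eq_iff card_insert_if power2_eq_square)
    finally show ?thesis .
  qed
  have "(\<Sum>e\<in>I. l e * of_bool (Y (k e) \<noteq> 0))\<^sup>2 =
      (\<Sum>e\<in>I. \<Sum>e'\<in>I. l e * l e' * indicator (?B e e') Y)" for Y
    by (simp add: power2_eq_square sum_product indicator_def of_bool_def)
      (auto intro!: sum.cong)
  then have "measure_pmf.expectation (Pi_pmf A 0 (\<lambda>_. p)) (\<lambda>Y. (\<Sum>e\<in>I. l e * of_bool (Y (k e) \<noteq> 0))\<^sup>2)
      = (\<Sum>e\<in>I. \<Sum>e'\<in>I. l e * l e' * measure ?M (?B e e'))"
    by (simp add: Bochner_Integration.integral_sum measure_pmf.emeasure_eq_measure)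
  also have "\<dots> \<le> (\<Sum>e\<in>I. \<Sum>e'\<in>I. l e * l e' * (q\<^sup>2 + of_bool (e = e') * q))"
    using l by (intro sum_mono mult_left_mono prob) auto
  also have "\<dots> = (\<Sum>e\<in>I. \<Sum>e'\<in>I. q\<^sup>2 * (l e * l e')) +
      (\<Sum>e\<in>I. \<Sum>e'\<in>I. if e' = e then q * (l e)\<^sup>2 else 0)"
    unfolding sum.distrib[symmetric]
    by (intro sum.cong) (auto simp: power2_eq_square algebra_simps)
  also have "\<dots> = q\<^sup>2 * (\<Sum>e\<in>I. l e)\<^sup>2 + q * (\<Sum>e\<in>I. (l e)\<^sup>2)"
    unfolding power2_eq_square[of "sum l I"] sum_product
    using fin(2) by (simp add: sum_distrib_left)
  finally show ?thesis .
qed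

text \<open>The probability is exactly \<open>2 / (1 + exp \<epsilon>)\<close>, and the quadratic
  Taylor bound for \<open>exp\<close> yields both rates. The first serves the \<open>num_C4'\<close>
  term, the second the squared number of triangles.\<close>

lemma prob_dlap_nonzero_le:
  assumes "\<epsilon> > 0"
  shows "measure_pmf.prob (dlap (exp (- \<epsilon>))) {y. y \<noteq> 0} \<le> 2 / \<epsilon>"
    and "measure_pmf.prob (dlap (exp (- \<epsilon>))) {y. y \<noteq> 0} \<le> 4 / \<epsilon>\<^sup>2"
proof -
  let ?D = "dlap (exp (- \<epsilon>))"
  have "{y. y \<noteq> 0} = UNIV - {0::int}" by auto
  then have "measure_pmf.prob ?D {y. y \<noteq> 0} = 1 - pmf ?D 0"
    using measure_pmf.prob_compl[of "{0}" ?D] by (simp add: measure_pmf_single)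
  also have "\<dots> = 2 / (1 + exp \<epsilon>)"
  proof -
    have "1 - (1 - inverse x) / (1 + inverse x) = 2 / (1 + x)" if "x > 0" for x :: real
      using that by (simp add: divide_simps)
    then show ?thesis using assms by (simp add: pmf_dlap) (simp add: exp_minus)
  qed
  finally have q: "measure_pmf.prob ?D {y. y \<noteq> 0} = 2 / (1 + exp \<epsilon>)" .
  have e: "1 + \<epsilon> + \<epsilon>\<^sup>2 / 2 \<le> exp \<epsilon>" using assms by (intro exp_lower_Taylor_quadratic) simp
  have "\<epsilon>\<^sup>2 > 0" using assms by simp
  with e assms have "\<epsilon> \<le> 1 + exp \<epsilon>" "\<epsilon>\<^sup>2 / 2 \<le> 1 + exp \<epsilon>" by linarith+
  then show "measure_pmf.prob ?D {y. y \<noteq> 0} \<le> 2 / \<epsilon>"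
    and "measure_pmf.prob ?D {y. y \<noteq> 0} \<le> 4 / \<epsilon>\<^sup>2"
    unfolding q using assms divide_left_mono[of "\<epsilon>\<^sup>2 / 2" "1 + exp \<epsilon>" 2] \<open>\<epsilon>\<^sup>2 > 0\<close>
    by (auto intro!: divide_left_mono mult_pos_pos add_pos_pos)
qed

section \<open>Mean squared error of the algorithm\<close>

context assigned_graph
begin

text \<open>This is Step 2 for fixed reports. The constant 4 is the factor 2 of the Laplace variance
  times the factor 2 of the handshake bound.\<close>

lemma nn_integral_node_releases:
  assumes "\<epsilon>2 > 0"
  shows "(\<integral>\<^sup>+ k. ennreal ((k - c)\<^sup>2) \<partial>distr (\<Pi>\<^sub>M v\<in>{1..n}. release \<epsilon>2 E w lam \<rho> w' v) borel
            (\<lambda>f. \<Sum>v\<in>{1..n}. f v)) \<le>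
    ennreal (((\<Sum>v\<in>{1..n}. biased_est E lam \<rho> w' v (restrict (w v) (nbh E v))) - c)\<^sup>2
      + 4 * (real (max_degree n E) * real (card E) / \<epsilon>2\<^sup>2))"
proof -
  have [measurable_cong]: "sets (release \<epsilon>2 E w lam \<rho> w' v) = sets borel" for v
    by (simp add: release_def)
  let ?\<mu> = "\<lambda>v. biased_est E lam \<rho> w' v (restrict (w v) (nbh E v))"
  have "(\<integral>\<^sup>+ k. ennreal ((k - c)\<^sup>2) \<partial>distr (\<Pi>\<^sub>M v\<in>{1..n}. release \<epsilon>2 E w lam \<rho> w' v) borel
            (\<lambda>f. \<Sum>v\<in>{1..n}. f v)) =
      (\<integral>\<^sup>+ x. ennreal (((\<Sum>v\<in>{1..n}. x v) - c)\<^sup>2) \<partial>(\<Pi>\<^sub>M v\<in>{1..n}. release \<epsilon>2 E w lam \<rho> w' v))"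
    by (rule nn_integral_distr) measurable
  also have "\<dots> \<le> ennreal (((\<Sum>v\<in>{1..n}. ?\<mu> v) - c)\<^sup>2
      + (\<Sum>v\<in>{1..n}. 2 * (real (card (nbh E v)) / \<epsilon>2)\<^sup>2))"
    using prob_space_release[OF graph assms] nn_integral_release_square[OF graph assms]
    by (intro nn_integral_PiM_sum_square_le) (auto simp: release_def)
  also have "(\<Sum>v\<in>{1..n}. 2 * (real (card (nbh E v)) / \<epsilon>2)\<^sup>2) =
      2 / \<epsilon>2\<^sup>2 * (\<Sum>v\<in>{1..n}. (real (card (nbh E v)))\<^sup>2)"
    by (simp add: sum_distrib_left power_divide)
  also have "ennreal (((\<Sum>v\<in>{1..n}. ?\<mu> v) - c)\<^sup>2 + \<dots>) \<le> ennreal (((\<Sum>v\<in>{1..n}. ?\<mu> v) - c)\<^sup>2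
      + 2 / \<epsilon>2\<^sup>2 * (2 * real (max_degree n E) * real (card E)))"
    using sum_degree_square_le[OF graph]
    by (intro ennreal_leI add_left_mono mult_left_mono) auto
  finally show ?thesis by (simp add: mult.assoc)
qed

lemma expectation_noisy_load_le:
  assumes "\<epsilon>1 > 0"
  shows "measure_pmf.expectation (Pi_pmf (arcs E) 0 (\<lambda>_. dlap (exp (- \<epsilon>1))))
      (\<lambda>Y. (\<Sum>e\<in>E. real (edge_load E \<rho> e) * of_bool (Y (edge_arc e) \<noteq> 0))\<^sup>2)
    \<le> 8 * ((real (card (triangles E)))\<^sup>2 / \<epsilon>1\<^sup>2) + 4 * (real (num_C4' E \<rho>) / \<epsilon>1)"
proof -
  define q where "q = measure_pmf.prob (dlap (exp (- \<epsilon>1))) {y. y \<noteq> 0}"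
  let ?D = "real (card (triangles E))" and ?C = "real (num_C4' E \<rho>)"
  have q: "0 \<le> q" "q \<le> 1" "q \<le> 2 / \<epsilon>1" "q \<le> 4 / \<epsilon>1\<^sup>2"
    using prob_dlap_nonzero_le[OF assms] by (auto simp: q_def)
  have "q\<^sup>2 \<le> q" using q by (simp add: power2_eq_square mult_left_le)
  with q have q2: "q\<^sup>2 \<le> 4 / \<epsilon>1\<^sup>2" by simp
  \<comment> \<open>The count is a natural number; this absorbs the linear term of the sum of
    squared loads into the quadratic one.\<close>
  have DD: "?D \<le> ?D\<^sup>2" by (cases "card (triangles E) = 0") (auto simp: power2_eq_square)
  have "measure_pmf.expectation (Pi_pmf (arcs E) 0 (\<lambda>_. dlap (exp (- \<epsilon>1))))
      (\<lambda>Y. (\<Sum>e\<in>E. real (edge_load E \<rho> e) * of_bool (Y (edge_arc e) \<noteq> 0))\<^sup>2)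
    \<le> q\<^sup>2 * (\<Sum>e\<in>E. real (edge_load E \<rho> e))\<^sup>2 + q * (\<Sum>e\<in>E. (real (edge_load E \<rho> e))\<^sup>2)"
    using graph by (intro expectation_square_Pi_pmf_le finite_arcs finite_edges edge_arc_inj_on)
      (auto simp: q_def edge_arc_in_arcs)
  also have "\<dots> = q\<^sup>2 * ?D\<^sup>2 + (q * ?D + q * (2 * ?C))"
    unfolding sum_edge_load sum_edge_load_square by (simp add: algebra_simps)
  also have "\<dots> \<le> 4 / \<epsilon>1\<^sup>2 * ?D\<^sup>2 + (4 / \<epsilon>1\<^sup>2 * ?D\<^sup>2 + 2 / \<epsilon>1 * (2 * ?C))"
    using q q2 DD assms by (intro add_mono mult_mono) auto
  finally show ?thesis by simp
qed

text \<open>Conditioning on the reports splits the error into a squared bias, bounded by the squared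
  noisy load, and a variance bound \<open>?V\<close> that is constant in the reports and leaves the
  outer integral.\<close>

lemma nn_integral_two_step_output_le:
  assumes "\<epsilon>1 > 0" "\<epsilon>2 > 0"
  shows "(\<integral>\<^sup>+ k. ennreal ((k - real (triangle_count E w lam))\<^sup>2)
        \<partial>two_step_output \<epsilon>1 \<epsilon>2 n E w lam \<rho>) \<le>
    ennreal (8 * (real (max_degree n E) * real (card E) / \<epsilon>2\<^sup>2
             + (real (card (triangles E)))\<^sup>2 / \<epsilon>1\<^sup>2
             + real (num_C4' E \<rho>) / \<epsilon>1))"
proof -
  let ?c = "real (triangle_count E w lam)"
  let ?Y = "Pi_pmf (arcs E) 0 (\<lambda>_. dlap (exp (- \<epsilon>1)))"
  let ?N = "\<lambda>wt. distr (\<Pi>\<^sub>M v\<in>{1..n}. release \<epsilon>2 E w lam \<rho> (noisy_weight wt) v) borel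
               (\<lambda>f. \<Sum>v\<in>{1..n}. f v)"
  let ?wt = "\<lambda>Y v u. w v u + Y (v, u)"
  let ?V = "4 * (real (max_degree n E) * real (card E) / \<epsilon>2\<^sup>2)"
  let ?Z = "\<lambda>Y. \<Sum>e\<in>E. real (edge_load E \<rho> e) * of_bool (Y (edge_arc e) \<noteq> (0::int))"
  \<comment> \<open>Every function on the discrete space of reports is measurable, so it suffices
    that each value is a probability measure.\<close>
  have N: "?N \<in> measurable (measure_pmf (step1 \<epsilon>1 E w)) (subprob_algebra borel)"
  proof -
    have "prob_space (?N wt)" for wt
    proof -
      have [measurable_cong]: "sets (release \<epsilon>2 E w lam \<rho> w' v) = sets borel" for w' v
        by (simp add: release_def)
      show ?thesis
        by (intro prob_space.prob_space_distr prob_space_PiM prob_space_release[OF graph] assms)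
          measurable
    qed
    then show ?thesis by (auto simp: space_subprob_algebra prob_space_imp_subprob_space)
  qed
  have "(\<integral>\<^sup>+ k. ennreal ((k - ?c)\<^sup>2) \<partial>two_step_output \<epsilon>1 \<epsilon>2 n E w lam \<rho>) =
      (\<integral>\<^sup>+ wt. \<integral>\<^sup>+ k. ennreal ((k - ?c)\<^sup>2) \<partial>?N wt \<partial>measure_pmf (step1 \<epsilon>1 E w))"
    unfolding two_step_output_def by (rule nn_integral_bind[OF _ N]) simp
  also have "\<dots> = (\<integral>\<^sup>+ Y. \<integral>\<^sup>+ k. ennreal ((k - ?c)\<^sup>2) \<partial>?N (?wt Y) \<partial>measure_pmf ?Y)"
    unfolding step1_def by (rule nn_integral_map_pmf)
  also have "\<dots> \<le> (\<integral>\<^sup>+ Y. ennreal ((?Z Y)\<^sup>2 + ?V) \<partial>measure_pmf ?Y)"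
  proof (intro nn_integral_mono order_trans[OF nn_integral_node_releases[OF assms(2)]]
      ennreal_leI add_right_mono)
    fix Y
    show "((\<Sum>v\<in>{1..n}. biased_est E lam \<rho> (noisy_weight (?wt Y)) v (restrict (w v) (nbh E v))) - ?c)\<^sup>2
        \<le> (?Z Y)\<^sup>2"
      unfolding sum_biased_est_eq using power_mono[OF count_error_le abs_ge_zero, of _ _ 2] by simp
  qed
  also have "\<dots> = (\<integral>\<^sup>+ Y. ennreal ((?Z Y)\<^sup>2) \<partial>measure_pmf ?Y) + ennreal ?V"
    by (simp add: nn_integral_add)
  also have "(\<integral>\<^sup>+ Y. ennreal ((?Z Y)\<^sup>2) \<partial>measure_pmf ?Y) =
      ennreal (measure_pmf.expectation ?Y (\<lambda>Y. (?Z Y)\<^sup>2))"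
  proof (rule nn_integral_eq_integral)
    \<comment> \<open>The load is bounded by the total of all \<open>edge_load\<close> values, hence
      its square is integrable.\<close>
    have "\<bar>?Z Y\<bar> \<le> (\<Sum>e\<in>E. real (edge_load E \<rho> e))" for Y
      by (rule order_trans[OF sum_abs]) (auto intro!: sum_mono)
    then have "(?Z Y)\<^sup>2 \<le> (\<Sum>e\<in>E. real (edge_load E \<rho> e))\<^sup>2" for Y
      using power_mono[of "\<bar>?Z Y\<bar>" _ 2] by simp
    then show "integrable (measure_pmf ?Y) (\<lambda>Y. (?Z Y)\<^sup>2)"
      by (intro measure_pmf.integrable_const_bound[where B = "(\<Sum>e\<in>E. real (edge_load E \<rho> e))\<^sup>2"])
        auto
  qed simp
  also have "ennreal (measure_pmf.expectation ?Y (\<lambda>Y. (?Z Y)\<^sup>2)) + ennreal ?V =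
      ennreal (measure_pmf.expectation ?Y (\<lambda>Y. (?Z Y)\<^sup>2) + ?V)"
    by (intro ennreal_plus[symmetric] Bochner_Integration.integral_nonneg) auto
  also have "\<dots> \<le> ennreal (8 * (real (max_degree n E) * real (card E) / \<epsilon>2\<^sup>2
             + (real (card (triangles E)))\<^sup>2 / \<epsilon>1\<^sup>2 + real (num_C4' E \<rho>) / \<epsilon>1))"
  proof (rule ennreal_leI)
    \<comment> \<open>Nonnegativity allows the constants 4 of these two terms to be raised to the
      common constant 8.\<close>
    have "0 \<le> real (max_degree n E) * real (card E) / \<epsilon>2\<^sup>2" "0 \<le> real (num_C4' E \<rho>) / \<epsilon>1"
      using assms by auto
    then show "measure_pmf.expectation ?Y (\<lambda>Y. (?Z Y)\<^sup>2) + ?V \<le>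
        8 * (real (max_degree n E) * real (card E) / \<epsilon>2\<^sup>2
             + (real (card (triangles E)))\<^sup>2 / \<epsilon>1\<^sup>2 + real (num_C4' E \<rho>) / \<epsilon>1)"
      using expectation_noisy_load_le[OF assms(1)] unfolding distrib_left by linarith
  qed
  finally show ?thesis .
qed

end

lemma integrable_and_integral_le_if_nn_integral_le:
  fixes f :: "'a \<Rightarrow> real"
  assumes f: "f \<in> borel_measurable M" "\<And>x. f x \<ge> 0" and B: "B \<ge> 0"
    and le: "(\<integral>\<^sup>+ x. ennreal (f x) \<partial>M) \<le> ennreal B"
  shows "integrable M f \<and> integral\<^sup>L M f \<le> B"
proof
  show int: "integrable M f"
    using f le by (intro integrableI_nonneg) (auto intro: le_less_trans)
  have "ennreal (integral\<^sup>L M f) \<le> ennreal B"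
    using le nn_integral_eq_integral[OF int] f(2) by simp
  then show "integral\<^sup>L M f \<le> B" using B by (simp add: ennreal_le_iff)
qed

text \<open>The constant is chosen before all parameters, which is the uniform meaning of the
  O-bound. Integrability is asserted too, since the Bochner integral of a non-integrable function is
  0 and a bound on it alone would say nothing.\<close>

theorem mainTheorem6:
  shows "\<exists>C>(0::real). \<forall>(n::nat) (E::nat set set) (w::nat \<Rightarrow> nat \<Rightarrow> int) (lam::int) (\<rho>::nat set \<Rightarrow> nat)
      (\<epsilon>1::real) (\<epsilon>2::real).
    simple_graph n E \<longrightarrow>
    (\<forall>u v. {u, v} \<in> E \<longrightarrow> w u v = w v u) \<longrightarrow>
    (\<forall>T\<in>triangles E. \<rho> T \<in> T) \<longrightarrow>
    \<epsilon>1 > 0 \<longrightarrow> \<epsilon>2 > 0 \<longrightarrow>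
    integrable (two_step_output \<epsilon>1 \<epsilon>2 n E w lam \<rho>)
      (\<lambda>k. (k - real (triangle_count E w lam))\<^sup>2) \<and>
    (\<integral>k. (k - real (triangle_count E w lam))\<^sup>2 \<partial>two_step_output \<epsilon>1 \<epsilon>2 n E w lam \<rho>)
      \<le> C * (real (max_degree n E) * real (card E) / \<epsilon>2\<^sup>2
             + (real (card (triangles E)))\<^sup>2 / \<epsilon>1\<^sup>2
             + real (num_C4' E \<rho>) / \<epsilon>1)"
proof (intro exI[of _ "8::real"] conjI[of "0 < (8::real)"] allI impI)
  fix n E and w :: "nat \<Rightarrow> nat \<Rightarrow> int" and lam \<rho> and \<epsilon>1 \<epsilon>2 :: real
  assume "simple_graph n E" "\<forall>u v. {u, v} \<in> E \<longrightarrow> w u v = w v u" "\<forall>T\<in>triangles E. \<rho> T \<in> T"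
    and eps: "\<epsilon>1 > 0" "\<epsilon>2 > 0"
  then interpret assigned_graph n E w \<rho> by unfold_locales auto
  have [measurable_cong]: "sets (two_step_output \<epsilon>1 \<epsilon>2 n E w lam \<rho>) = sets borel"
    unfolding two_step_output_def by (rule sets_bind) auto
  show "integrable (two_step_output \<epsilon>1 \<epsilon>2 n E w lam \<rho>)
      (\<lambda>k. (k - real (triangle_count E w lam))\<^sup>2) \<and>
    (\<integral>k. (k - real (triangle_count E w lam))\<^sup>2 \<partial>two_step_output \<epsilon>1 \<epsilon>2 n E w lam \<rho>)
      \<le> 8 * (real (max_degree n E) * real (card E) / \<epsilon>2\<^sup>2
             + (real (card (triangles E)))\<^sup>2 / \<epsilon>1\<^sup>2
             + real (num_C4' E \<rho>) / \<epsilon>1)"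
    using eps by (intro integrable_and_integral_le_if_nn_integral_le nn_integral_two_step_output_le) auto
qed simp

end
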